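(* Let $H\colon \mathbb{R}^{2n}\to\mathbb{R}$ be a smooth proper function, bounded from below, whose only critical point is its minimum, and let $h>\min H$. Let $c_H(s)=c_{HZ}(\{H<s\})$, $s>\min H$, be the Hofer--Zehnder capacity function of $H$. Assume that the lower derivative $$\underline{D}\,c_H(h)=\liminf_{\delta\to 0}\frac{c_H(h+\delta)-c_H(h)}{\delta}$$ is finite. Then the level $\{H=h\}$ carries a periodic orbit of the Hamiltonian flow of $H$ with period $T\le \underline{D}\,c_H(h)$ and, as a consequence, $\underline{D}\,c_H(h)>0$.
   Context: $\mathbb{R}^{2n}$ carries its standard symplectic structure. In the lower derivative, $\delta\to0$ from both sides. Hofer--Zehnder capacity: let $V$ be a symplectic manifold without boundary (here a nonempty open subset of $\mathbb{R}^{2n}$). $\mathcal{H}_{HZ}(V)$ is the class of smooth non-negative functions $K$ on $V$ such that $K$ is compactly supported if $V$ is not closed (or $K$ vanishes on some nonempty open set if $V$ is compact), and $K$ is constant near its maximum. A non-trivial (non-constant) periodic orbit of the (autonomous) Hamiltonian flow of $K$ with period $T\le 1$ is called fast. $K\in\mathcal{H}_{HZ}(V)$ is admissible if its Hamiltonian flow has no non-trivial fast periodic orbits. Then $$c_{HZ}(V)=\sup\{\max K\mid K\in\mathcal{H}_{HZ}(V),\ K \text{ admissible}\}\in(0,\infty].$$ It is a known theorem of Hofer and Zehnder that $c_{HZ}(V)<\infty$ for bounded open $V\subset\mathbb{R}^{2n}$; hence $c_H$ is a finite monotone increasing function on $(\min H,\infty)$. *)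

theory Defs
  imports "HOL-Analysis.Analysis"
begin

section \<open>Smooth functions on open sets\<close>

text \<open>
  The two predicates below are meant for open \<open>S\<close>; only the values of \<open>f\<close> on \<open>S\<close> matter then.
\<close>

fun Ck_on :: "nat \<Rightarrow> 'a::euclidean_space set \<Rightarrow> ('a \<Rightarrow> real) \<Rightarrow> bool" where
  "Ck_on 0 S f \<longleftrightarrow> continuous_on S f"
| "Ck_on (Suc k) S f \<longleftrightarrow>
     (\<forall>x\<in>S. f differentiable (at x)) \<and>
     (\<forall>v. Ck_on k S (\<lambda>x. frechet_derivative f (at x) v))"

definition smooth_on :: "'a::euclidean_space set \<Rightarrow> ('a \<Rightarrow> real) \<Rightarrow> bool" where
  "smooth_on S f \<longleftrightarrow> (\<forall>k. Ck_on k S f)"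


section \<open>Hamiltonian dynamics on the standard symplectic vector space\<close>

text \<open>Points of \<open>\<real>\<^sup>2\<^sup>n\<close> are pairs \<open>(q, p)\<close>, with \<open>n = CARD('n)\<close>.\<close>

type_synonym 'n phase = "(real ^ 'n) \<times> (real ^ 'n)"

text \<open>The form \<open>\<Sum>i. dq\<^sub>i \<and> dp\<^sub>i\<close>.\<close>

definition symp_form :: "'n::finite phase \<Rightarrow> 'n phase \<Rightarrow> real" where
  "symp_form u v = fst u \<bullet> snd v - snd u \<bullet> fst v"

text \<open>
  Sign convention: \<open>\<omega>(X\<^sub>H, \<cdot>) = dH\<close>, which gives \<open>q' = \<partial>H/\<partial>p\<close>, \<open>p' = -\<partial>H/\<partial>q\<close>. The opposite
  convention only reverses time.
\<close>

definition hamiltonian_vf :: "('n::finite phase \<Rightarrow> real) \<Rightarrow> 'n phase \<Rightarrow> 'n phase" where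
  "hamiltonian_vf H x = (THE X. \<forall>v. symp_form X v = frechet_derivative H (at x) v)"

lemma hamiltonian_vf_unique:
  assumes "\<forall>v. symp_form X v = frechet_derivative H (at x) v"
  shows "hamiltonian_vf H x = X"
  unfolding hamiltonian_vf_def
proof (rule the_equality)
  fix Y :: "'a phase"
  assume Y: "\<forall>v. symp_form Y v = frechet_derivative H (at x) v"
  have "symp_form Y v = symp_form X v" for v
    using assms Y by metis
  from this[of "(0, fst X - fst Y)"] this[of "(snd X - snd Y, 0)"]
  have "(fst X - fst Y) \<bullet> (fst X - fst Y) = 0" "(snd X - snd Y) \<bullet> (snd X - snd Y) = 0"
    by (auto simp: symp_form_def inner_diff_left)
  then show "Y = X" by (simp add: prod_eq_iff)
qed (rule assms)

lemma hamiltonian_vf_eq: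
  assumes "H differentiable (at x)"
  shows "hamiltonian_vf H x =
    ((\<Sum>b\<in>Basis. frechet_derivative H (at x) (0, b) *\<^sub>R b),
     - (\<Sum>b\<in>Basis. frechet_derivative H (at x) (b, 0) *\<^sub>R b))"
proof (rule hamiltonian_vf_unique, rule allI)
  fix v :: "'a phase"
  let ?D = "frechet_derivative H (at x)"
  have lin: "linear ?D"
    using assms by (rule linear_frechet_derivative)
  have 1: "?D (0, p) = (\<Sum>b\<in>Basis. ?D (0, b) *\<^sub>R b) \<bullet> p" for p
  proof -
    have "linear (\<lambda>p. ?D (0, p))"
      using linear_compose[OF _ lin, of "\<lambda>p. (0, p)"] by (simp add: o_def linear_iff)
    from Linear_Algebra.linear_componentwise[OF this, of p 1] show ?thesis
      by (simp add: inner_sum_left inner_sum_right mult.commute inner_commute)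
  qed
  have 2: "?D (q, 0) = (\<Sum>b\<in>Basis. ?D (b, 0) *\<^sub>R b) \<bullet> q" for q
  proof -
    have "linear (\<lambda>q. ?D (q, 0))"
      using linear_compose[OF _ lin, of "\<lambda>q. (q, 0)"] by (simp add: o_def linear_iff)
    from Linear_Algebra.linear_componentwise[OF this, of q 1] show ?thesis
      by (simp add: inner_sum_left inner_sum_right mult.commute inner_commute)
  qed
  have "?D v = ?D (fst v, 0) + ?D (0, snd v)"
    using linear_add[OF lin, of "(fst v, 0)" "(0, snd v)"] by simp
  then show "symp_form ((\<Sum>b\<in>Basis. ?D (0, b) *\<^sub>R b), - (\<Sum>b\<in>Basis. ?D (b, 0) *\<^sub>R b)) v = ?D v"
    by (simp only: 1[of "snd v"] 2[of "fst v"] symp_form_def fst_conv snd_conv inner_minus_left)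
qed

text \<open>
  \<open>T\<close> is any positive period, not necessarily the minimal one.
\<close>

definition periodic_orbit ::
  "('n::finite phase \<Rightarrow> real) \<Rightarrow> 'n phase set \<Rightarrow> (real \<Rightarrow> 'n phase) \<Rightarrow> real \<Rightarrow> bool" where
  "periodic_orbit H V \<gamma> T \<longleftrightarrow>
     T > 0 \<and>
     (\<forall>t. \<gamma> t \<in> V) \<and>
     (\<forall>t. (\<gamma> has_vector_derivative hamiltonian_vf H (\<gamma> t)) (at t)) \<and>
     (\<forall>t. \<gamma> (t + T) = \<gamma> t)"

definition nontrivial_periodic_orbit ::
  "('n::finite phase \<Rightarrow> real) \<Rightarrow> 'n phase set \<Rightarrow> (real \<Rightarrow> 'n phase) \<Rightarrow> real \<Rightarrow> bool" where
  "nontrivial_periodic_orbit H V \<gamma> T \<longleftrightarrow>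
     periodic_orbit H V \<gamma> T \<and> \<not> \<gamma> constant_on UNIV"


section \<open>The Hofer--Zehnder capacity of open subsets\<close>

text \<open>
  Nonempty open subsets of \<open>\<real>\<^sup>2\<^sup>n\<close> (\<open>n \<ge> 1\<close>) are never compact, so only the compactly supported
  variant of the class occurs. ``Constant near its maximum'' means that the maximum is attained on
  some nonempty open set. (It cannot mean constancy near the whole set of maximum points: that set
  would then be open and, for \<open>K \<noteq> 0\<close>, compact.)
\<close>

definition HZ_class :: "'n::finite phase set \<Rightarrow> ('n phase \<Rightarrow> real) set" where
  "HZ_class V = {K. smooth_on V K \<and> (\<forall>x\<in>V. K x \<ge> 0) \<and>
     compact (V \<inter> closure {x\<in>V. K x \<noteq> 0}) \<and>
     (\<exists>U. open U \<and> U \<noteq> {} \<and> U \<subseteq> V \<and> (\<forall>x\<in>U. \<forall>y\<in>V. K y \<le> K x))}"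

definition HZ_admissible :: "'n::finite phase set \<Rightarrow> ('n phase \<Rightarrow> real) \<Rightarrow> bool" where
  "HZ_admissible V K \<longleftrightarrow>
     K \<in> HZ_class V \<and> \<not> (\<exists>\<gamma> T. nontrivial_periodic_orbit K V \<gamma> T \<and> T \<le> 1)"

text \<open>For \<open>K\<close> in the class, \<open>Sup (K ` V)\<close> is attained, i.e. it is \<open>max K\<close>.\<close>

definition HZ_capacity :: "'n::finite phase set \<Rightarrow> ereal" where
  "HZ_capacity V = (SUP K\<in>{K. HZ_admissible V K}. ereal (Sup (K ` V)))"

definition capacity_function :: "('n::finite phase \<Rightarrow> real) \<Rightarrow> real \<Rightarrow> ereal" where
  "capacity_function H s = HZ_capacity {x. H x < s}"

text \<open>
  \<open>Liminf (at 0)\<close> is over \<open>\<delta> \<noteq> 0\<close> of both signs. For \<open>ereal\<close>, \<open>\<infinity> - \<infinity> = \<infinity>\<close>, so if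
  \<open>c h = \<infinity>\<close> then every quotient is infinite; hence, for
  \<open>c = capacity_function H\<close> (which is \<open>\<ge> 0\<close> above \<open>min H\<close>), a finite lower derivative forces
  \<open>c h\<close> to be finite.
\<close>

definition lower_derivative :: "(real \<Rightarrow> ereal) \<Rightarrow> real \<Rightarrow> ereal" where
  "lower_derivative c h = Liminf (at 0) (\<lambda>\<delta>. (c (h + \<delta>) - c h) / ereal \<delta>)"

end

theory Submission
  imports Defs "HOL-Complex_Analysis.Great_Picard"
begin

text \<open>
  If \<open>\<tau>\<close> exceeds the lower derivative, then arbitrarily close to \<open>h\<close> there are \<open>a < b\<close> with
  \<open>c\<^sub>H(b) < c\<^sub>H(a) + \<tau>(b - a)\<close>. An almost optimal admissible \<open>K\<close> on \<open>{H < a}\<close>, extended by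
  zero, can be raised to \<open>K + f \<circ> H\<close>, where the cutoff \<open>f\<close> falls from at least
  \<open>\<tau>(b - a)\<close> to \<open>0\<close> between \<open>a\<close> and \<open>b\<close> with slope barely above \<open>\<tau>\<close>. The sum is too high to be admissible on \<open>{H < b}\<close>, and its fast orbit
  must lie on a level of \<open>H\<close> between \<open>a\<close> and \<open>b\<close>, where it is a reparametrized orbit of \<open>H\<close> of
  period at most the slope. Rescaled to period one, these orbits converge by Arzela-Ascoli to an orbit
  on \<open>{H = h}\<close>; their periods do not tend to \<open>0\<close> because the vector field does not vanish there.
\<close>

section \<open>Smooth functions and cutoffs\<close>

lemma frechet_derivative_cong_open:
  assumes "open S" "x \<in> S" "\<And>y. y \<in> S \<Longrightarrow> f y = g y"
  shows "frechet_derivative f (at x) = frechet_derivative g (at x)"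
proof -
  have "(f has_derivative D) (at x) \<longleftrightarrow> (g has_derivative D) (at x)" for D
    using has_derivative_transform_within_open[of f D x UNIV S g]
      has_derivative_transform_within_open[of g D x UNIV S f] assms by auto
  then show ?thesis
    by (simp add: frechet_derivative_def)
qed

lemma Ck_on_cong:
  assumes "open S" "\<And>x. x \<in> S \<Longrightarrow> f x = g x" "Ck_on k S f"
  shows "Ck_on k S g"
  using assms(2,3)
proof (induction k arbitrary: f g)
  case 0
  then show ?case by (auto cong: continuous_on_cong)
next
  case (Suc k)
  have "g differentiable (at x)" if "x \<in> S" for x
  proof -
    have "f differentiable (at x)"
      using Suc.prems(2) that by simp
    then obtain D where "(f has_derivative D) (at x)"
      unfolding differentiable_def by blast
    then have "(g has_derivative D) (at x)"
      by (rule has_derivative_transform_within_open) (use Suc.prems(1) that assms(1) in auto)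
    then show ?thesis by (auto simp: differentiable_def)
  qed
  moreover have "Ck_on k S (\<lambda>x. frechet_derivative g (at x) v)" for v
  proof (rule Suc.IH)
    show "Ck_on k S (\<lambda>x. frechet_derivative f (at x) v)"
      using Suc.prems by simp
    show "frechet_derivative f (at x) v = frechet_derivative g (at x) v" if "x \<in> S" for x
      using frechet_derivative_cong_open[OF assms(1) that] Suc.prems(1) by metis
  qed
  ultimately show ?case by simp
qed

lemma Ck_on_subset:
  assumes "Ck_on k S f" "T \<subseteq> S"
  shows "Ck_on k T f"
  using assms
  by (induction k arbitrary: f) (auto intro: continuous_on_subset)

text \<open>Differentiability in \<open>Ck_on\<close> refers to the full filter \<open>at x\<close>
  at each point, so openness matters only for gluing continuity.\<close>

lemma Ck_on_Un:
  assumes "open S" "open T" "Ck_on k S f" "Ck_on k T f"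
  shows "Ck_on k (S \<union> T) f"
  using assms(3,4)
  by (induction k arbitrary: f) (auto intro: continuous_on_open_Un assms(1,2))

lemma Ck_on_SucD: "Ck_on (Suc k) S f \<Longrightarrow> Ck_on k S f"
proof (induction k arbitrary: f)
  case 0
  then show ?case
    by (auto intro!: continuous_at_imp_continuous_on differentiable_imp_continuous_within)
qed auto

text \<open>Allows any explicit formula \<open>D\<close> in place of
  \<open>frechet_derivative\<close>: derivatives are unique, so the two agree on \<open>S\<close>,
  and openness carries the agreement over to the higher orders.\<close>

lemma Ck_on_SucI:
  assumes "open S" "\<And>x. x \<in> S \<Longrightarrow> (f has_derivative D x) (at x)"
    and "\<And>v. Ck_on k S (\<lambda>x. D x v)"
  shows "Ck_on (Suc k) S f"
proof -
  have "D x = frechet_derivative f (at x)" if "x \<in> S" for x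
    using frechet_derivative_at assms(2) that by blast
  then have "Ck_on k S (\<lambda>x. frechet_derivative f (at x) v)" for v
    using Ck_on_cong[OF assms(1) _ assms(3)[of v]] by simp
  then show ?thesis
    using assms(2) by (auto simp: differentiable_def)
qed

lemma Ck_on_SucE:
  assumes "Ck_on (Suc k) S f" "x \<in> S"
  shows "(f has_derivative frechet_derivative f (at x)) (at x)"
  using assms frechet_derivative_works by auto

lemma Ck_on_const: "open S \<Longrightarrow> Ck_on k S (\<lambda>x. c)"
proof (induction k arbitrary: c)
  case (Suc k)
  show ?case
    by (rule Ck_on_SucI[OF Suc.prems has_derivative_const]) (use Suc in simp)
qed simp

lemma Ck_on_add:
  assumes "open S" "Ck_on k S f" "Ck_on k S g"
  shows "Ck_on k S (\<lambda>x. f x + g x)"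
  using assms(2,3)
proof (induction k arbitrary: f g)
  case 0
  then show ?case by (auto intro: continuous_intros)
next
  case (Suc k)
  show ?case
  proof (rule Ck_on_SucI[OF assms(1)])
    show "((\<lambda>x. f x + g x) has_derivative
      (\<lambda>v. frechet_derivative f (at x) v + frechet_derivative g (at x) v)) (at x)" if "x \<in> S" for x
      using Suc.prems that by (intro has_derivative_add Ck_on_SucE)
  qed (use Suc in simp)
qed

lemma Ck_on_mult:
  assumes "open S" "Ck_on k S f" "Ck_on k S g"
  shows "Ck_on k S (\<lambda>x. f x * g x)"
  using assms(2,3)
proof (induction k arbitrary: f g)
  case 0
  then show ?case by (auto intro: continuous_intros)
next
  case (Suc k)
  show ?case
  proof (rule Ck_on_SucI[OF assms(1)])
    show "((\<lambda>x. f x * g x) has_derivative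
      (\<lambda>v. f x * frechet_derivative g (at x) v + frechet_derivative f (at x) v * g x)) (at x)"
      if "x \<in> S" for x
      using Suc.prems that by (intro has_derivative_mult Ck_on_SucE)
    show "Ck_on k S (\<lambda>x. f x * frechet_derivative g (at x) v
        + frechet_derivative f (at x) v * g x)" for v
      using Suc.prems Suc.prems[THEN Ck_on_SucD] by (intro Ck_on_add Suc.IH assms(1)) auto
  qed
qed

text \<open>The chain rule gives the derivative of \<open>f\<close> at \<open>g x\<close> times the
  derivative of \<open>g\<close>. Only the outer function changes in this step, so the induction
  generalizes \<open>f\<close> alone and the product rule does the rest.\<close>

lemma Ck_on_compose_real:
  fixes f :: "real \<Rightarrow> real"
  assumes "open S" "Ck_on k UNIV f" "Ck_on k S g"
  shows "Ck_on k S (\<lambda>x. f (g x))"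
  using assms(2,3)
proof (induction k arbitrary: f)
  case 0
  then show ?case
    using continuous_on_compose2[of UNIV f S g] by simp
next
  case (Suc k)
  let ?f' = "\<lambda>t. frechet_derivative f (at t) 1"
  have Df: "frechet_derivative f (at t) u = ?f' t * u" for t u
    using linear_scale[OF linear_frechet_derivative[of f "at t"], of u 1] Suc.prems(1) by simp
  show ?case
  proof (rule Ck_on_SucI[OF assms(1)])
    show "((\<lambda>x. f (g x)) has_derivative
        (\<lambda>v. ?f' (g x) * frechet_derivative g (at x) v)) (at x)" if "x \<in> S" for x
    proof -
      have "((\<lambda>x. f (g x)) has_derivative
          (\<lambda>v. frechet_derivative f (at (g x)) (frechet_derivative g (at x) v))) (at x)"
        by (rule has_derivative_compose[OF Ck_on_SucE[OF Suc.prems(2) that]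
              Ck_on_SucE[OF Suc.prems(1) UNIV_I]])
      then show ?thesis
        by (rule has_derivative_eq_rhs) (rule ext, rule Df)
    qed
    show "Ck_on k S (\<lambda>x. ?f' (g x) * frechet_derivative g (at x) v)" for v
    proof (rule Ck_on_mult[OF assms(1)])
      show "Ck_on k S (\<lambda>x. ?f' (g x))"
        by (rule Suc.IH[OF _ Ck_on_SucD[OF Suc.prems(2)]]) (use Suc.prems(1) in simp)
    qed (use Suc.prems(2) in simp)
  qed
qed

lemma Ck_on_real_SucI:
  fixes f f' :: "real \<Rightarrow> real"
  assumes "\<And>t. (f has_real_derivative f' t) (at t)" "Ck_on k UNIV f'"
  shows "Ck_on (Suc k) UNIV f"
proof (rule Ck_on_SucI)
  show "(f has_derivative (\<lambda>v. f' t * v)) (at t)" for t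
    using assms(1) by (simp add: has_field_derivative_def)
  show "Ck_on k UNIV (\<lambda>t. f' t * v)" for v
    by (intro Ck_on_mult Ck_on_const assms(2) open_UNIV)
qed simp

section \<open>Flat functions and a cutoff of prescribed slope\<close>

text \<open>The classical flat function \<open>exp (- 1 / t)\<close> divided by powers of
  \<open>t\<close>. Differentiating one member of the family gives a combination of two others, so
  one induction over the order makes all of them smooth.\<close>

definition flat_exp :: "nat \<Rightarrow> real \<Rightarrow> real" where
  "flat_exp m t = (if t \<le> 0 then 0 else exp (- 1 / t) / t ^ m)"

lemma flat_exp_has_derivative:
  "(flat_exp m has_real_derivative (flat_exp (m + 2) t - m * flat_exp (m + 1) t)) (at t)"
proof -
  consider "t < 0" | "t > 0" | "t = 0" by linarith
  then show ?thesis
  proof cases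
    case 1
    have "(flat_exp m has_real_derivative 0) (at t)"
      by (rule has_field_derivative_transform_within[of "\<lambda>_. 0" _ _ _ "- t"])
        (use 1 in \<open>auto simp: flat_exp_def dist_real_def\<close>)
    then show ?thesis using 1 by (simp add: flat_exp_def)
  next
    case 2
    have pw: "((\<lambda>t. t ^ m) has_real_derivative real m * t ^ m / t) (at t)"
      using DERIV_pow[of m t] 2 by (cases m) auto
    have ex: "((\<lambda>t. exp (- 1 / t)) has_real_derivative exp (- 1 / t) / t ^ 2) (at t)"
      using 2 by (auto intro!: derivative_eq_intros simp: power2_eq_square)
    have "t ^ m \<noteq> 0" using 2 by simp
    from DERIV_divide[OF ex pw this]
    have "((\<lambda>t. exp (- 1 / t) / t ^ m) has_real_derivative
        (flat_exp (m + 2) t - m * flat_exp (m + 1) t)) (at t)"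
      by (rule DERIV_cong) (use 2 in \<open>simp add: flat_exp_def field_simps power2_eq_square\<close>)
    then show ?thesis
      by (rule has_field_derivative_transform_within[where d = t])
        (use 2 in \<open>auto simp: flat_exp_def dist_real_def\<close>)
  next
    case 3
    \<comment> \<open>With \<open>x = 1 / h\<close> the difference quotient becomes
      \<open>x ^ (m + 1) / exp x\<close>, which tends to zero at infinity.\<close>
    have "((\<lambda>h. flat_exp m h / h) \<longlongrightarrow> 0) (at_right 0)"
    proof (rule Lim_transform_eventually)
      have "((\<lambda>x::real. x ^ (m + 1) / exp x) \<longlongrightarrow> 0) at_top"
        by (rule tendsto_power_div_exp_0)
      from filterlim_compose[OF this filterlim_inverse_at_top_right]
      show "((\<lambda>h::real. inverse h ^ (m + 1) / exp (inverse h)) \<longlongrightarrow> 0) (at_right 0)" .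
      show "\<forall>\<^sub>F h in at_right 0. inverse h ^ (m + 1) / exp (inverse h) = flat_exp m h / h"
        by (rule eventually_at_rightI[of _ 1])
          (auto simp: flat_exp_def exp_minus field_simps)
    qed
    moreover have "((\<lambda>h. flat_exp m h / h) \<longlongrightarrow> 0) (at_left 0)"
      by (rule Lim_transform_eventually[of "\<lambda>_. 0"])
        (auto simp: flat_exp_def intro!: eventually_at_leftI[of "-1"])
    ultimately have "((\<lambda>h. flat_exp m h / h) \<longlongrightarrow> 0) (at 0)"
      by (simp add: filterlim_split_at)
    then show ?thesis
      using 3 by (simp add: DERIV_def flat_exp_def)
  qed
qed

lemma Ck_on_flat_exp: "Ck_on k UNIV (flat_exp m)"
proof (induction k arbitrary: m)
  case 0
  then show ?case
    by (auto intro!: continuous_at_imp_continuous_on DERIV_isCont flat_exp_has_derivative)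
next
  case (Suc k)
  have "Ck_on k UNIV (\<lambda>t. flat_exp (m + 2) t + (- real m) * flat_exp (m + 1) t)"
    by (intro Ck_on_add Ck_on_mult Ck_on_const Suc) auto
  then show ?case
    by (intro Ck_on_real_SucI[OF flat_exp_has_derivative]) simp
qed

lemma flat_exp_nonneg: "flat_exp m t \<ge> 0"
  by (simp add: flat_exp_def)

lemma flat_exp_pos: "t > 0 \<Longrightarrow> flat_exp m t > 0"
  by (simp add: flat_exp_def)

lemma Ck_on_exp: "Ck_on k UNIV (exp :: real \<Rightarrow> real)"
proof (induction k)
  case 0
  then show ?case by (simp add: continuous_on_exp)
next
  case (Suc k)
  show ?case by (rule Ck_on_real_SucI[OF DERIV_exp Suc])
qed

lemma Ck_on_affine: "Ck_on k UNIV (\<lambda>t::real. u * t + w)"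
proof (cases k)
  case 0
  then show ?thesis by (auto intro!: continuous_intros)
next
  case (Suc j)
  have "((\<lambda>t. u * t + w) has_real_derivative u) (at t)" for t
    by (auto intro!: derivative_eq_intros)
  then show ?thesis
    unfolding Suc by (rule Ck_on_real_SucI[OF _ Ck_on_const[OF open_UNIV]])
qed

text \<open>A drop of \<open>\<tau> * (b - a)\<close> over the length \<open>b - a\<close> has mean
  slope \<tau>; the gap between \<tau> and \<sigma> is what the smoothing at both ends uses up.
  Reaching zero at \<open>b'\<close>, strictly before \<open>b\<close>, will keep the support
  compact inside \<open>{H < b}\<close>.\<close>

lemma smooth_cutoff_with_slope:
  fixes a b \<tau> \<sigma> :: real
  assumes "a < b" "0 < \<tau>" "\<tau> < \<sigma>"
  obtains f f' :: "real \<Rightarrow> real" and b' c where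
    "\<And>k. Ck_on k UNIV f" "\<And>t. (f has_real_derivative f' t) (at t)"
    "\<And>t. \<bar>f' t\<bar> \<le> \<sigma>" "\<And>t. t \<le> a \<Longrightarrow> f t = c" "\<And>t. t \<le> a \<Longrightarrow> f' t = 0" "b' < b"
    "\<And>t. t \<ge> b' \<Longrightarrow> f t = 0" "\<And>t. 0 \<le> f t" "\<And>t. f t \<le> c" "c \<ge> \<tau> * (b - a)"
proof -
  \<comment> \<open>The fraction of the drop \<open>\<sigma> * (b - a)\<close> at full slope that
    has to be achieved.\<close>
  define r where "r = \<tau> / \<sigma>"
  have r: "0 < r" "r < 1" "\<tau> = r * \<sigma>" using assms by (simp_all add: r_def)
  \<comment> \<open>Removing three pieces of length \<open>lam\<close> leaves the fraction
    \<open>(1 + r) / 2\<close> of the interval: one piece after \<open>a\<close>, one before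
    \<open>b'\<close> and one between \<open>b'\<close> and \<open>b\<close>.\<close>
  define lam where "lam = (b - a) * (1 - r) / 6"
  have lam: "lam > 0" using assms r by (simp add: lam_def)
  have len: "b - 2 * lam - (a + lam) = (b - a) * ((1 + r) / 2)"
    by (simp add: lam_def field_simps)
  also have "\<dots> > 0" using assms r by simp
  finally have ord: "a + lam < b - 2 * lam" by simp
  define b' where "b' = b - lam"
  \<comment> \<open>A bump that is positive exactly between \<open>a\<close> and \<open>b'\<close>.
    Its affine arguments are spelled out so as to match \<open>Ck_on_affine\<close>.\<close>
  define \<beta> where "\<beta> t = flat_exp 0 (1 * t + (- a)) * flat_exp 0 ((-1) * t + b')" for t
  have \<beta>_Ck: "Ck_on k UNIV \<beta>" for k
    unfolding \<beta>_def[abs_def] by (intro Ck_on_mult Ck_on_compose_real[OF _ Ck_on_flat_exp Ck_on_affine] open_UNIV)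
  have \<beta>0: "\<beta> t = 0" if "t \<le> a \<or> t \<ge> b'" for t
    using that by (auto simp: \<beta>_def flat_exp_def)
  have \<beta>nn: "\<beta> t \<ge> 0" for t by (simp add: \<beta>_def flat_exp_nonneg)
  have "\<exists>x\<in>{a + lam..b - 2 * lam}. \<forall>y\<in>{a + lam..b - 2 * lam}. \<beta> x \<le> \<beta> y"
    using ord continuous_on_subset[OF _ subset_UNIV] \<beta>_Ck[of 0]
    by (intro continuous_attains_inf) simp_all
  then obtain x0 where x0: "x0 \<in> {a + lam..b - 2 * lam}"
      "\<And>y. y \<in> {a + lam..b - 2 * lam} \<Longrightarrow> \<beta> x0 \<le> \<beta> y" by blast
  have m: "\<beta> x0 > 0"
    unfolding \<beta>_def using x0(1) lam by (auto intro!: mult_pos_pos flat_exp_pos simp: b'_def)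
  \<comment> \<open>Chosen so that the saturated bump \<open>1 - exp (- N * \<beta> t)\<close>
    equals \<open>(1 + r) / 2\<close> at the minimum point \<open>x0\<close>, and is at least that
    large on the whole middle interval.\<close>
  define N where "N = - ln ((1 - r) / 2) / \<beta> x0"
  have "ln ((1 - r) / 2) < 0" using r by simp
  then have N: "N > 0" using m by (simp add: N_def divide_neg_pos)
  have expN: "exp (- N * \<beta> x0) = (1 - r) / 2"
    using m r by (simp add: N_def)
  \<comment> \<open>Minus the derivative of the cutoff: within the factor \<open>(1 + r) / 2\<close> of its bound \<open>\<sigma>\<close> on an interval
    of relative length \<open>(1 + r) / 2\<close>, so that the total drop is at least \<open>r\<sigma>(b - a)\<close>.\<close>
  define g where "g t = \<sigma> * (1 + (-1) * exp ((- N) * \<beta> t + 0))" for t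
  have g_Ck: "Ck_on k UNIV g" for k
    unfolding g_def[abs_def]
    by (intro Ck_on_mult Ck_on_add Ck_on_const Ck_on_compose_real[OF _ Ck_on_exp]
        Ck_on_compose_real[OF _ Ck_on_affine \<beta>_Ck] open_UNIV)
  have g0: "g t = 0" if "t \<le> a \<or> t \<ge> b'" for t
    using \<beta>0[OF that] by (simp add: g_def)
  have gnn: "0 \<le> g t" for t
    using assms N \<beta>nn[of t] by (simp add: g_def)
  have gle: "g t \<le> \<sigma>" for t
    using assms by (simp add: g_def)
  have glow: "\<sigma> * ((1 + r) / 2) \<le> g t" if "t \<in> {a + lam..b - 2 * lam}" for t
  proof -
    have "exp (- N * \<beta> t) \<le> exp (- N * \<beta> x0)"
      using x0(2)[OF that] N by simp
    then have "(1 + r) / 2 \<le> 1 - exp (- N * \<beta> t)"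
      unfolding expN by (simp add: field_simps)
    then show ?thesis using assms by (simp add: g_def)
  qed
  have "isCont g t" for t
    using g_Ck[of 0] by (simp add: continuous_on_eq_continuous_at)
  then obtain G where "\<forall>t. -\<infinity> < ereal t \<longrightarrow> ereal t < \<infinity> \<longrightarrow> (G has_vector_derivative g t) (at t)"
    using einterval_antiderivative[of "-\<infinity>" \<infinity> g] by auto
  then have G: "(G has_real_derivative g t) (at t)" for t
    by (simp add: has_real_derivative_iff_has_vector_derivative)
  have Gmono: "G s \<le> G t" if "s \<le> t" for s t
    using DERIV_nonneg_imp_nondecreasing[OF that] G gnn by blast
  have Gcont: "continuous_on S G" for S
    using G by (auto intro!: continuous_at_imp_continuous_on DERIV_isCont)
  have Gconst: "G s = G t" if "s \<le> t" "\<And>u. s \<le> u \<Longrightarrow> u \<le> t \<Longrightarrow> g u = 0" for s t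
  proof (rule antisym)
    show "G s \<le> G t" by (rule Gmono[OF that(1)])
    have "\<exists>y. (G has_real_derivative y) (at u) \<and> y \<le> 0" if "s \<le> u" "u \<le> t" for u
      using G[of u] \<open>\<And>u. s \<le> u \<Longrightarrow> u \<le> t \<Longrightarrow> g u = 0\<close>[OF that] by auto
    then show "G t \<le> G s" by (rule DERIV_nonpos_imp_nonincreasing[OF that(1)])
  qed
  define f where "f t = G b' + (-1) * G t" for t
  have Gl: "G t = G a" if "t \<le> a" for t
    by (rule Gconst[OF that]) (rule g0, simp)
  have Gr: "G t = G b'" if "t \<ge> b'" for t
    by (rule Gconst[OF that, symmetric]) (rule g0, simp)
  have "f t = f a" if "t \<le> a" for t
    by (simp add: f_def Gl[OF that])
  moreover have "f t = 0" if "t \<ge> b'" for t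
    by (simp add: f_def Gr[OF that])
  moreover have "f t \<le> f a" for t
    unfolding f_def using Gmono[of a t] Gl[of t] by linarith
  moreover have "f t \<ge> 0" for t
    unfolding f_def using Gmono[of t b'] Gr[of t] by linarith
  moreover have "f a \<ge> \<tau> * (b - a)"
  proof -
    obtain \<xi> where \<xi>: "a + lam < \<xi>" "\<xi> < b - 2 * lam"
        "G (b - 2 * lam) - G (a + lam) = (b - 2 * lam - (a + lam)) * g \<xi>"
      using MVT2[OF ord, of G g] G by blast
    \<comment> \<open>The difference of the two sides is \<open>((1 - r) / 2) ^ 2\<close>. One
      factor will be the relative length of the middle interval, the other the relative height of
      \<open>g\<close> on it.\<close>
    have "r \<le> ((1 + r) / 2) * ((1 + r) / 2)"
      using zero_le_power2[of "1 - r"] by (simp add: power2_eq_square field_simps)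
    then have "(b - a) * \<sigma> * r \<le> (b - a) * \<sigma> * (((1 + r) / 2) * ((1 + r) / 2))"
      using assms by (intro mult_left_mono) auto
    also have "\<dots> = (b - 2 * lam - (a + lam)) * (\<sigma> * ((1 + r) / 2))"
      unfolding len by (simp add: mult_ac)
    also have "\<dots> \<le> (b - 2 * lam - (a + lam)) * g \<xi>"
      using glow[of \<xi>] \<xi> ord by (intro mult_left_mono) auto
    also have "\<dots> \<le> G b' - G a"
      using \<xi>(3) Gmono[of a "a + lam"] Gmono[of "b - 2 * lam" b'] lam by (simp add: b'_def)
    finally show ?thesis
      using r(3) by (simp add: f_def mult_ac)
  qed
  moreover have f': "(f has_real_derivative - g t) (at t)" for t
    unfolding f_def[abs_def] by (auto intro!: derivative_eq_intros G)
  moreover have "Ck_on k UNIV f" for k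
  proof (rule Ck_on_SucD, rule Ck_on_real_SucI[OF f'])
    show "Ck_on k UNIV (\<lambda>t. - g t)"
      using Ck_on_mult[OF _ Ck_on_const[of UNIV k "-1"] g_Ck[of k]] by simp
  qed
  moreover have "\<bar>- g t\<bar> \<le> \<sigma>" for t using gle[of t] gnn[of t] by simp
  moreover have "- g t = 0" if "t \<le> a" for t using g0 that by simp
  moreover have "b' < b" using lam by (simp add: b'_def)
  ultimately show ?thesis by (intro that[of f "\<lambda>t. - g t" "f a" b'])
qed

section \<open>Limits of periodic orbits\<close>

text \<open>\<open>w\<close> is the Euclidean gradient, and rotating it by
  \<open>(q, p) \<mapsto> (p, - q)\<close> solves the equation behind the definite description in
  \<open>hamiltonian_vf\<close>. The explicit form makes continuity visible.\<close>

lemma hamiltonian_vf_gradient: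
  fixes f :: "'n::finite phase \<Rightarrow> real"
  assumes "f differentiable (at x)"
  defines "w \<equiv> (\<Sum>b\<in>Basis. frechet_derivative f (at x) b *\<^sub>R b)"
  shows "hamiltonian_vf f x = (snd w, - fst w)"
    and "symp_form (hamiltonian_vf f x) v = frechet_derivative f (at x) v"
proof -
  let ?D = "frechet_derivative f (at x)"
  have lin: "linear ?D"
    using assms(1) by (rule linear_frechet_derivative)
  have grad: "?D v = w \<bullet> v" for v
  proof -
    have "?D v = ?D (\<Sum>b\<in>Basis. (v \<bullet> b) *\<^sub>R b)"
      by (simp only: euclidean_representation)
    also have "\<dots> = (\<Sum>b\<in>Basis. (v \<bullet> b) * ?D b)"
      by (simp only: linear_sum[OF lin] linear_scale[OF lin] real_scaleR_def)
    also have "\<dots> = w \<bullet> v"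
      by (simp add: w_def inner_sum_left inner_commute[of v] mult.commute)
    finally show ?thesis .
  qed
  have symp: "symp_form (snd w, - fst w) v = ?D v" for v
    unfolding grad inner_prod_def[of w v] by (simp add: symp_form_def inner_commute)
  show eq: "hamiltonian_vf f x = (snd w, - fst w)"
    by (rule hamiltonian_vf_unique) (use symp in blast)
  show "symp_form (hamiltonian_vf f x) v = ?D v"
    unfolding eq by (rule symp)
qed

lemma symp_form_refl: "symp_form u u = 0"
  by (simp add: symp_form_def inner_commute)

lemma symp_form_scaleR_left: "symp_form (c *\<^sub>R u) v = c * symp_form u v"
  by (simp add: symp_form_def algebra_simps)

lemma continuous_on_hamiltonian_vf:
  fixes f :: "'n::finite phase \<Rightarrow> real"
  assumes "Ck_on 1 UNIV f"
  shows "continuous_on UNIV (hamiltonian_vf f)"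
proof -
  have "continuous_on UNIV (\<lambda>x. frechet_derivative f (at x) v)" for v
    using assms unfolding One_nat_def Ck_on.simps by blast
  then have "continuous_on UNIV (\<lambda>x. \<Sum>b\<in>Basis. frechet_derivative f (at x) b *\<^sub>R b)"
    by (intro continuous_intros)
  then have "continuous_on UNIV (\<lambda>x.
      (snd (\<Sum>b\<in>Basis. frechet_derivative f (at x) b *\<^sub>R b),
       - fst (\<Sum>b\<in>Basis. frechet_derivative f (at x) b *\<^sub>R b)))"
    by (intro continuous_on_Pair continuous_on_minus continuous_on_snd continuous_on_fst)
  moreover have "f differentiable (at x)" for x
    using assms unfolding One_nat_def Ck_on.simps by blast
  ultimately show ?thesis
    using hamiltonian_vf_gradient(1)[of f] by (simp cong: continuous_on_cong)
qed

section \<open>Compactness of periodic solutions of bounded period\<close>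

text \<open>With time rescaled to period one, the original periods are the factors
  \<open>\<tau> n\<close> in the equation. Their bound makes the curves uniformly Lipschitz, so
  Arzela-Ascoli applies, and uniform convergence of the derivatives carries the equation to the
  limit.\<close>

lemma periodic_solutions_subsequence_limit:
  fixes X :: "'a::euclidean_space \<Rightarrow> 'a" and \<eta> :: "nat \<Rightarrow> real \<Rightarrow> 'a" and \<tau> :: "nat \<Rightarrow> real"
  assumes "compact C" "continuous_on C X"
    and der: "\<And>n t. (\<eta> n has_vector_derivative \<tau> n *\<^sub>R X (\<eta> n t)) (at t)"
    and per: "\<And>n t. \<eta> n (t + 1) = \<eta> n t"
    and C: "\<And>n t. \<eta> n t \<in> C"
    and \<tau>: "\<And>n. 0 < \<tau> n" "\<And>n. \<tau> n \<le> M"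
    and nz: "\<And>x. x \<in> C \<Longrightarrow> X x \<noteq> 0"
  obtains k g l where "strict_mono (k :: nat \<Rightarrow> nat)" "(\<lambda>n. \<tau> (k n)) \<longlonglongrightarrow> l" "0 < l"
    "\<And>t. (\<lambda>n. \<eta> (k n) t) \<longlonglongrightarrow> g t"
    "\<And>t. (g has_vector_derivative l *\<^sub>R X (g t)) (at t)"
    "\<And>t. g (t + 1) = g t" "\<And>t. g t \<in> C"
proof -
  have "compact (X ` C)" by (rule compact_continuous_image[OF assms(2,1)])
  then obtain B where B: "B > 0" "\<And>x. x \<in> C \<Longrightarrow> norm (X x) \<le> B"
    by (metis bounded_pos compact_imp_bounded imageI)
  have M: "M > 0" using \<tau>[of 0] by linarith
  have Lip: "norm (\<eta> n x - \<eta> n y) \<le> M * B * norm (x - y)" for n x y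
  proof (rule differentiable_bound[OF convex_UNIV])
    show "(\<eta> n has_derivative (\<lambda>h. h *\<^sub>R (\<tau> n *\<^sub>R X (\<eta> n t)))) (at t within UNIV)" for t
      using der by (simp add: has_vector_derivative_def)
    show "onorm (\<lambda>h. h *\<^sub>R (\<tau> n *\<^sub>R X (\<eta> n t))) \<le> M * B" for t
    proof (rule onorm_le)
      fix u :: real
      have "\<tau> n * norm (X (\<eta> n t)) \<le> M * B"
        using \<tau>[of n] B C[of n t] by (intro mult_mono) auto
      from mult_left_mono[OF this, of "\<bar>u\<bar>"]
      show "norm (u *\<^sub>R (\<tau> n *\<^sub>R X (\<eta> n t))) \<le> M * B * norm u"
        using \<tau>(1)[of n] by (simp add: abs_mult mult_ac)
    qed
  qed auto
  have "\<forall>n. \<tau> n \<in> {0..M}" using \<tau> by (auto intro: less_imp_le)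
  then obtain l k1 where k1: "l \<in> {0..M}" "strict_mono (k1 :: nat \<Rightarrow> nat)" "(\<tau> \<circ> k1) \<longlonglongrightarrow> l"
    using compact_Icc[of 0 M] unfolding compact_def by metis
  obtain R where R: "\<And>x. x \<in> C \<Longrightarrow> norm x \<le> R"
    using compact_imp_bounded[OF assms(1)] by (auto simp: bounded_iff)
  obtain g0 k2 where k2: "strict_mono (k2 :: nat \<Rightarrow> nat)"
    "\<And>e. 0 < e \<Longrightarrow> \<exists>N. \<forall>n x. n \<ge> N \<and> x \<in> {0..1} \<longrightarrow> norm (\<eta> (k1 (k2 n)) x - g0 x) < e"
  proof (rule Arzela_Ascoli[of "{0..1::real}" "\<lambda>n. \<eta> (k1 n)" R])
    show "\<exists>d>0. \<forall>n y. y \<in> {0..1} \<and> norm (x - y) < d \<longrightarrow> norm (\<eta> (k1 n) x - \<eta> (k1 n) y) < e"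
      if "0 < e" for x e
    proof (intro exI[of _ "e / (M * B)"] conjI allI impI)
      fix n y assume y: "y \<in> {0..1} \<and> norm (x - y) < e / (M * B)"
      have "M * B * norm (x - y) < M * B * (e / (M * B))"
        using y M B(1) by (intro mult_strict_left_mono) auto
      also have "\<dots> = e" using M B(1) by simp
      finally show "norm (\<eta> (k1 n) x - \<eta> (k1 n) y) < e"
        using Lip[of "k1 n" x y] by linarith
    qed (use that M B(1) in auto)
  qed (use R C in auto)
  define k where "k = k1 \<circ> k2"
  have k: "strict_mono k" unfolding k_def by (rule strict_mono_o[OF k1(2) k2(1)])
  have l: "(\<lambda>n. \<tau> (k n)) \<longlonglongrightarrow> l"
    using LIMSEQ_subseq_LIMSEQ[OF k1(3) k2(1)] by (simp add: k_def o_def)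
  \<comment> \<open>Arzela-Ascoli yields the limit only on \<open>{0..1}\<close>;
    \<open>frac\<close> extends it periodically, and the periodicity of \<open>\<eta> n\<close>
    makes the convergence uniform on the whole line.\<close>
  define g where "g t = g0 (frac t)" for t
  have frac: "\<eta> n (frac t) = \<eta> n t" for n t
  proof -
    interpret periodic_fun_simple' "\<eta> n" by standard (rule per)
    show ?thesis using plus_of_int[of "frac t" "\<lfloor>t\<rfloor>"] by (simp add: frac_def)
  qed
  have unif: "uniform_limit UNIV (\<lambda>n. \<eta> (k n)) g sequentially"
  proof (rule uniform_limitI)
    fix e :: real assume "0 < e"
    then obtain N where "\<forall>n x. n \<ge> N \<and> x \<in> {0..1} \<longrightarrow> norm (\<eta> (k1 (k2 n)) x - g0 x) < e"
      using k2(2) by blast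
    then have "norm (\<eta> (k1 (k2 n)) (frac t) - g0 (frac t)) < e" if "n \<ge> N" for n t
      using that frac_lt_1[of t] frac_ge_0[of t] by simp
    then have "dist (\<eta> (k n) t) (g t) < e" if "n \<ge> N" for n t
      using that by (simp add: dist_norm g_def k_def frac)
    then show "\<forall>\<^sub>F n in sequentially. \<forall>t\<in>UNIV. dist (\<eta> (k n) t) (g t) < e"
      using eventually_sequentially by auto
  qed
  have lim: "(\<lambda>n. \<eta> (k n) t) \<longlonglongrightarrow> g t" for t
    using tendsto_uniform_limitI[OF unif] by simp
  have gC: "g t \<in> C" for t
    by (rule closed_sequentially[OF compact_imp_closed[OF assms(1)] C lim])
  have gper: "g (t + 1) = g t" for t
    by (rule LIMSEQ_unique[OF lim]) (simp add: per lim)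
  have uc: "uniformly_continuous_on C X"
    by (rule compact_uniformly_continuous[OF assms(2,1)])
  have unifX: "uniform_limit UNIV (\<lambda>n t. X (\<eta> (k n) t)) (\<lambda>t. X (g t)) sequentially"
    by (rule uniform_limit_compose_uniformly_continuous_on[OF unif uc])
      (use C gC compact_imp_closed[OF assms(1)] in auto)
  have gder: "(g has_vector_derivative l *\<^sub>R X (g t)) (at t)" for t
  proof -
    have "uniform_limit UNIV (\<lambda>n t. \<tau> (k n) *\<^sub>R X (\<eta> (k n) t)) (\<lambda>t. l *\<^sub>R X (g t)) sequentially"
    proof (rule bounded_bilinear.bounded_uniform_limit[OF bounded_bilinear_scaleR _ unifX])
      show "uniform_limit UNIV (\<lambda>n t. \<tau> (k n)) (\<lambda>t. l) sequentially"
        using l by (auto intro!: uniform_limitI simp: tendsto_iff)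
      show "bounded ((\<lambda>t::real. X (g t)) ` UNIV)"
        using B(2) gC by (auto simp: bounded_iff)
    qed auto
    then have ev: "\<forall>\<^sub>F n in sequentially. \<forall>t\<in>UNIV.
        norm (\<tau> (k n) *\<^sub>R X (\<eta> (k n) t) - l *\<^sub>R X (g t)) < e" if "e > 0" for e
      using that unfolding uniform_limit_iff dist_norm by blast
    have "\<exists>g'. \<forall>x\<in>UNIV. (\<lambda>n. \<eta> (k n) x) \<longlonglongrightarrow> g' x \<and>
        (g' has_derivative (\<lambda>h. h *\<^sub>R (l *\<^sub>R X (g x)))) (at x within UNIV)"
    proof (rule has_derivative_sequence)
      show "(\<eta> (k n) has_derivative (\<lambda>h. h *\<^sub>R (\<tau> (k n) *\<^sub>R X (\<eta> (k n) x)))) (at x within UNIV)" for n x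
        using der by (simp add: has_vector_derivative_def)
      show "\<forall>\<^sub>F n in sequentially. \<forall>x\<in>UNIV. \<forall>h. norm (h *\<^sub>R (\<tau> (k n) *\<^sub>R X (\<eta> (k n) x)) -
          h *\<^sub>R (l *\<^sub>R X (g x))) \<le> e * norm h" if "e > 0" for e
        using ev[OF that]
      proof eventually_elim
        case (elim n)
        show ?case
        proof (intro ballI allI)
          fix x h :: real
          have "norm (h *\<^sub>R (\<tau> (k n) *\<^sub>R X (\<eta> (k n) x)) - h *\<^sub>R (l *\<^sub>R X (g x)))
              = norm (\<tau> (k n) *\<^sub>R X (\<eta> (k n) x) - l *\<^sub>R X (g x)) * norm h"
            by (simp only: scaleR_diff_right[symmetric] norm_scaleR real_norm_def mult.commute)
          also have "\<dots> \<le> e * norm h"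
            using elim by (intro mult_right_mono) (auto intro: less_imp_le)
          finally show "norm (h *\<^sub>R (\<tau> (k n) *\<^sub>R X (\<eta> (k n) x)) - h *\<^sub>R (l *\<^sub>R X (g x))) \<le> e * norm h" .
        qed
      qed
      show "(\<lambda>n. \<eta> (k n) 0) \<longlonglongrightarrow> g 0" by (rule lim)
    qed simp_all
    \<comment> \<open>Here \<open>g'\<close> is a limit function supplied by the theorem on
      differentiating sequences, not a derivative; pointwise limits identify it with
      \<open>g\<close>.\<close>
    then obtain g' where g': "\<And>x. (\<lambda>n. \<eta> (k n) x) \<longlonglongrightarrow> g' x"
      "\<And>x. (g' has_derivative (\<lambda>h. h *\<^sub>R (l *\<^sub>R X (g x)))) (at x)" by auto
    have "g' = g" using LIMSEQ_unique[OF g'(1) lim] by blast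
    then show ?thesis using g'(2) by (simp add: has_vector_derivative_def)
  qed
  \<comment> \<open>If the periods shrank to zero, the curves would converge to a point \<open>p\<close> and eventually move
    strictly in the direction \<open>X p\<close>, so they could not close up.\<close>
  have "l \<noteq> 0"
  proof
    assume "l = 0"
    then have "(g has_derivative (\<lambda>h. 0)) (at x within UNIV)" for x
      using gder[of x] by (simp add: has_vector_derivative_def)
    then obtain p where p: "\<And>t. g t = p"
      using has_derivative_zero_constant[of UNIV g] by auto
    define v where "v = X p"
    have v: "norm v > 0" using nz gC[of 0] p by (simp add: v_def)
    have "\<forall>\<^sub>F n in sequentially. \<forall>t\<in>UNIV. dist (X (\<eta> (k n) t)) (X (g t)) < norm v"
      using unifX v unfolding uniform_limit_iff by blast
    then obtain n where n: "\<And>t. norm (X (\<eta> (k n) t) - v) < norm v"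
      unfolding eventually_sequentially p v_def dist_norm by blast
    have "X (\<eta> (k n) t) \<bullet> v > 0" for t
    proof -
      have "\<bar>(X (\<eta> (k n) t) - v) \<bullet> v\<bar> \<le> norm (X (\<eta> (k n) t) - v) * norm v"
        by (rule Cauchy_Schwarz_ineq2)
      also have "\<dots> < norm v * norm v" using n v by (rule mult_strict_right_mono)
      also have "\<dots> = v \<bullet> v" by (simp add: power2_norm_eq_inner[symmetric] power2_eq_square)
      finally show ?thesis by (simp add: inner_diff_left)
    qed
    then have pos: "\<tau> (k n) * (X (\<eta> (k n) t) \<bullet> v) > 0" for t
      using \<tau>(1) by simp
    have "((\<lambda>t. \<eta> (k n) t \<bullet> v) has_real_derivative \<tau> (k n) * (X (\<eta> (k n) t) \<bullet> v)) (at t)" for t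
      using bounded_linear.has_vector_derivative[OF bounded_linear_inner_left[of v] der[of "k n" t]]
      by (simp add: has_real_derivative_iff_has_vector_derivative)
    then have "\<eta> (k n) 0 \<bullet> v < \<eta> (k n) 1 \<bullet> v"
      using pos DERIV_pos_imp_increasing[of 0 1 "\<lambda>t. \<eta> (k n) t \<bullet> v"] by force
    then show False using per[of "k n" 0] by simp
  qed
  then have "l > 0" using k1(1) by simp
  then show ?thesis
    using that[OF k l _ lim gder gper gC] by blast
qed

text \<open>The periods \<open>T n\<close> need not converge, so a subsequence is extracted, and the
  convergent bounds \<open>S n\<close> control its limit. The set \<open>C\<close> keeps the orbits
  away from the zeros of the field.\<close>

lemma periodic_orbit_limit:
  fixes H :: "'n::finite phase \<Rightarrow> real"
  assumes "continuous_on UNIV H" "continuous_on UNIV (hamiltonian_vf H)" "compact C"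
    and orb: "\<And>n. periodic_orbit H {x. H x = s n} (\<gamma> n) (T n)"
    and inC: "\<And>n t. \<gamma> n t \<in> C"
    and nz: "\<And>x. x \<in> C \<Longrightarrow> hamiltonian_vf H x \<noteq> 0"
    and lim: "s \<longlonglongrightarrow> h" "S \<longlonglongrightarrow> L" "\<And>n. T n \<le> S n"
  obtains \<gamma>' T' where "nontrivial_periodic_orbit H {x. H x = h} \<gamma>' T'" "T' \<le> L"
proof -
  let ?X = "hamiltonian_vf H"
  define \<eta> where "\<eta> n t = \<gamma> n (T n * t)" for n t
  have der\<gamma>: "(\<gamma> n has_vector_derivative ?X (\<gamma> n t)) (at t)"
    and T: "T n > 0" and lev: "H (\<gamma> n t) = s n" and per: "\<gamma> n (t + T n) = \<gamma> n t" for n t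
    using orb[of n] by (auto simp: periodic_orbit_def)
  obtain M where "\<And>n. norm (S n) \<le> M"
    using convergent_imp_bounded[OF lim(2)] by (auto simp: bounded_iff)
  then have TM: "T n \<le> M" for n
    using lim(3)[of n] by (metis abs_ge_self order_trans real_norm_def)
  have der: "(\<eta> n has_vector_derivative T n *\<^sub>R ?X (\<eta> n t)) (at t)" for n t
  proof -
    have "((\<lambda>t. T n * t) has_real_derivative T n) (at t)"
      by (auto intro!: derivative_eq_intros)
    from vector_diff_chain_at[OF this[unfolded has_real_derivative_iff_has_vector_derivative] der\<gamma>]
    show ?thesis by (simp add: \<eta>_def[abs_def] o_def)
  qed
  have eper: "\<eta> n (t + 1) = \<eta> n t" for n t
    using per[of n "T n * t"] by (simp add: \<eta>_def algebra_simps)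
  have eC: "\<eta> n t \<in> C" for n t using inC by (simp add: \<eta>_def)
  obtain k g l where k: "strict_mono (k :: nat \<Rightarrow> nat)" "(\<lambda>n. T (k n)) \<longlonglongrightarrow> l" "0 < l"
    and g: "\<And>t. (\<lambda>n. \<eta> (k n) t) \<longlonglongrightarrow> g t"
    "\<And>t. (g has_vector_derivative l *\<^sub>R ?X (g t)) (at t)"
    "\<And>t. g (t + 1) = g t" "\<And>t. g t \<in> C"
    by (rule periodic_solutions_subsequence_limit[where \<eta> = \<eta> and \<tau> = T,
          OF assms(3) continuous_on_subset[OF assms(2)] der eper eC T TM nz])
      auto
  \<comment> \<open>Undoes the rescaling: period one becomes period \<open>l\<close>, and the factor
    \<open>l\<close> in the equation cancels.\<close>
  define \<gamma>' where "\<gamma>' t = g (t / l)" for t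
  have der': "(\<gamma>' has_vector_derivative ?X (\<gamma>' t)) (at t)" for t
  proof -
    have "((\<lambda>t. t / l) has_real_derivative 1 / l) (at t)"
      using k(3) by (auto intro!: derivative_eq_intros)
    from vector_diff_chain_at[OF this[unfolded has_real_derivative_iff_has_vector_derivative] g(2)]
    show ?thesis using k(3) by (simp add: \<gamma>'_def[abs_def] o_def)
  qed
  have "H (g t) = h" for t
  proof -
    have "isCont H (g t)"
      using assms(1) continuous_on_eq_continuous_at[OF open_UNIV] by blast
    from isCont_tendsto_compose[OF this g(1)]
    have "(\<lambda>n. s (k n)) \<longlonglongrightarrow> H (g t)" by (simp add: \<eta>_def lev)
    moreover have "(\<lambda>n. s (k n)) \<longlonglongrightarrow> h"
      using LIMSEQ_subseq_LIMSEQ[OF lim(1) k(1)] by (simp add: o_def)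
    ultimately show ?thesis by (rule LIMSEQ_unique)
  qed
  then have lev': "H (\<gamma>' t) = h" for t by (simp add: \<gamma>'_def)
  have per': "\<gamma>' (t + l) = \<gamma>' t" for t
  proof -
    have "(t + l) / l = t / l + 1" using k(3) by (simp add: field_simps)
    then show ?thesis by (simp only: \<gamma>'_def g(3))
  qed
  have orbit: "periodic_orbit H {x. H x = h} \<gamma>' l"
    unfolding periodic_orbit_def using k(3) der' lev' per' by blast
  \<comment> \<open>A constant curve would have zero velocity and so put a zero of the field into
    \<open>C\<close>.\<close>
  have "\<not> \<gamma>' constant_on UNIV"
  proof
    assume "\<gamma>' constant_on UNIV"
    then obtain p where "\<gamma>' = (\<lambda>t. p)" by (auto simp: constant_on_def)
    then have "?X (\<gamma>' 0) = 0"
      using der'[of 0] vector_derivative_unique_at[OF _ has_vector_derivative_const] by metis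
    then show False using nz g(4) by (simp add: \<gamma>'_def)
  qed
  moreover have "l \<le> L"
  proof (rule LIMSEQ_le[OF k(2)])
    show "(\<lambda>n. S (k n)) \<longlonglongrightarrow> L"
      using LIMSEQ_subseq_LIMSEQ[OF lim(2) k(1)] by (simp add: o_def)
  qed (use lim(3) in blast)
  ultimately show ?thesis
    using that orbit by (auto simp: nontrivial_periodic_orbit_def)
qed

section \<open>Orbits from capacity growth\<close>

text \<open>The factor \<open>c\<close> will be the slope of a descending cutoff, hence may be
  negative; the orbit is then traversed backwards, which is why the period scales by
  \<open>\<bar>c\<bar>\<close>.\<close>

lemma periodic_orbit_reparametrize:
  assumes "periodic_orbit F V \<gamma> T"
    and c: "\<And>t. hamiltonian_vf F (\<gamma> t) = c *\<^sub>R hamiltonian_vf H (\<gamma> t)" "c \<noteq> 0"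
    and W: "\<And>t. \<gamma> t \<in> W"
  shows "periodic_orbit H W (\<lambda>t. \<gamma> (t / c)) (\<bar>c\<bar> * T)"
proof -
  have T: "T > 0" and der: "(\<gamma> has_vector_derivative hamiltonian_vf F (\<gamma> t)) (at t)"
    and per: "\<gamma> (t + T) = \<gamma> t" for t
    using assms(1) by (auto simp: periodic_orbit_def)
  have "((\<lambda>t. \<gamma> (t / c)) has_vector_derivative hamiltonian_vf H (\<gamma> (t / c))) (at t)" for t
  proof -
    have "((\<lambda>t. t / c) has_real_derivative 1 / c) (at t)"
      using c(2) by (auto intro!: derivative_eq_intros)
    from vector_diff_chain_at[OF this[unfolded has_real_derivative_iff_has_vector_derivative] der]
    show ?thesis using c by (simp add: o_def)
  qed
  moreover have "\<gamma> ((t + \<bar>c\<bar> * T) / c) = \<gamma> (t / c)" for t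
  proof (cases "c > 0")
    case True
    then show ?thesis using per[of "t / c"] by (simp add: add_divide_distrib)
  next
    case False
    then have "(t + \<bar>c\<bar> * T) / c = t / c - T"
      using c(2) by (simp add: diff_divide_distrib)
    then show ?thesis using per[of "t / c - T"] by simp
  qed
  ultimately show ?thesis
    using T c(2) W by (simp add: periodic_orbit_def)
qed

text \<open>
  Along an orbit of \<open>K + f \<circ> H\<close> the function \<open>K\<close> is constant, because \<open>f' \<circ> H\<close> vanishes wherever
  \<open>dK\<close> does not. If \<open>K > 0\<close> on the orbit, it is an orbit of \<open>K\<close> inside \<open>{H < a}\<close>; if \<open>K = 0\<close>, then
  \<open>dK = 0\<close> there since \<open>K \<ge> 0\<close>, and the orbit is a reparametrized orbit of \<open>H\<close>.
\<close>

lemma fast_orbit_of_admissible_plus_cutoff: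
  fixes H K :: "'n::finite phase \<Rightarrow> real" and f f' :: "real \<Rightarrow> real"
  assumes Hd: "\<And>x. H differentiable (at x)" and Kd: "\<And>x. K differentiable (at x)" and K_nonneg: "\<And>x. 0 \<le> K x"
    and K_supp: "\<And>x. a \<le> H x \<Longrightarrow> K x = 0"
    and f: "\<And>t. (f has_real_derivative f' t) (at t)" "\<And>t. t \<le> a \<Longrightarrow> f' t = 0"
    and no_fast: "\<And>\<gamma> T. nontrivial_periodic_orbit K {x. H x < a} \<gamma> T \<Longrightarrow> 1 < T"
    and orbit: "nontrivial_periodic_orbit (\<lambda>x. K x + f (H x)) V \<gamma> T" "T \<le> 1"
  obtains s where "a < s" "\<And>t. H (\<gamma> t) = s" "f' s \<noteq> 0"
    "periodic_orbit H {x. H x = s} (\<lambda>t. \<gamma> (t / f' s)) (\<bar>f' s\<bar> * T)"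
proof -
  let ?F = "\<lambda>x. K x + f (H x)"
  let ?DH = "\<lambda>x. frechet_derivative H (at x)" and ?DK = "\<lambda>x. frechet_derivative K (at x)"
  have F_der: "(?F has_derivative (\<lambda>v. ?DK x v + f' (H x) * ?DH x v)) (at x)" for x
  proof (rule has_derivative_add)
    show "(K has_derivative ?DK x) (at x)"
      using Kd frechet_derivative_works by blast
    show "((\<lambda>x. f (H x)) has_derivative (\<lambda>v. f' (H x) * ?DH x v)) (at x)"
      using has_derivative_compose[of H "?DH x" x UNIV f "(*) (f' (H x))"] Hd[of x] f(1)[of "H x"]
        frechet_derivative_works by (auto simp: has_field_derivative_def)
  qed
  have Fd: "?F differentiable (at x)" for x
    using F_der unfolding differentiable_def by blast
  have DF: "frechet_derivative ?F (at x) v = ?DK x v + f' (H x) * ?DH x v" for x v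
    by (simp only: frechet_derivative_at[OF F_der[of x], symmetric])
  have XK: "symp_form (hamiltonian_vf K x) v = ?DK x v"
    and XH: "symp_form (hamiltonian_vf H x) v = ?DH x v" for x v
    using hamiltonian_vf_gradient(2) Kd Hd by blast+
  have DK0: "?DK x v = 0" if "K x = 0" for x v
  proof -
    have "(K has_derivative ?DK x) (at x)"
      using Kd frechet_derivative_works by blast
    then have "?DK x = (\<lambda>v. 0)"
      by (rule has_derivative_local_min) (simp add: that K_nonneg)
    then show ?thesis by simp
  qed
  have XF_inside: "hamiltonian_vf ?F x = hamiltonian_vf K x" if "f' (H x) = 0" for x
    by (rule hamiltonian_vf_unique) (simp only: DF XK that mult_zero_left add_0_right, blast)
  have XF_outside: "hamiltonian_vf ?F x = f' (H x) *\<^sub>R hamiltonian_vf H x" if "K x = 0" for x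
    by (rule hamiltonian_vf_unique)
      (simp only: DF XH DK0[OF that] symp_form_scaleR_left add_0_left, blast)
  have per: "periodic_orbit ?F V \<gamma> T" and nonconst: "\<not> \<gamma> constant_on UNIV"
    using orbit(1) by (auto simp: nontrivial_periodic_orbit_def)
  then have der: "(\<gamma> has_vector_derivative hamiltonian_vf ?F (\<gamma> t)) (at t)" for t
    by (auto simp: periodic_orbit_def)
  \<comment> \<open>A function whose differential annihilates the field along the orbit is a first
    integral. This is applied to \<open>K\<close>, and to \<open>H\<close> once the field is known
    to be parallel to that of \<open>H\<close>.\<close>
  have constant_along: "\<exists>c. \<forall>t. g (\<gamma> t) = c"
    if "\<And>x. g differentiable (at x)" "\<And>t. frechet_derivative g (at (\<gamma> t)) (hamiltonian_vf ?F (\<gamma> t)) = 0"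
    for g :: "'n phase \<Rightarrow> real"
  proof -
    have "((\<lambda>t. g (\<gamma> t)) has_derivative (\<lambda>h. 0)) (at t within UNIV)" for t
    proof -
      have gd: "(g has_derivative frechet_derivative g (at (\<gamma> t))) (at (\<gamma> t))"
        using that(1) frechet_derivative_works by blast
      have "((\<lambda>t. g (\<gamma> t)) has_derivative
          (\<lambda>h. frechet_derivative g (at (\<gamma> t)) (h *\<^sub>R hamiltonian_vf ?F (\<gamma> t)))) (at t)"
        by (rule has_derivative_compose[OF der[unfolded has_vector_derivative_def] gd])
      then show ?thesis
        using linear_scale[OF has_derivative_linear[OF gd]] that(2) by simp
    qed
    then show ?thesis
      using has_derivative_zero_constant[of UNIV "\<lambda>t. g (\<gamma> t)"] by auto
  qed
  \<comment> \<open>Where \<open>a \<le> H x\<close>, \<open>dK\<close> vanishes. Below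
    \<open>a\<close> the cutoff is flat, the field is that of \<open>K\<close>, and
    \<open>dK\<close> of it is the form evaluated on two equal vectors.\<close>
  have "?DK x (hamiltonian_vf ?F x) = 0" for x
  proof (cases "a \<le> H x")
    case True
    then show ?thesis by (intro DK0 K_supp)
  next
    case False
    then show ?thesis
      using XF_inside[of x] f(2)[of "H x"] XK[of x "hamiltonian_vf K x"] by (simp add: symp_form_refl)
  qed
  then obtain k where k: "\<And>t. K (\<gamma> t) = k"
    using constant_along[of K] Kd by blast
  have "k = 0"
  proof (rule ccontr)
    assume "k \<noteq> 0"
    then have inside: "H (\<gamma> t) < a" for t
      using K_supp k by (metis not_le)
    then have "nontrivial_periodic_orbit K {x. H x < a} \<gamma> T"
      using orbit(1) f(2)[OF less_imp_le] XF_inside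
      by (auto simp: nontrivial_periodic_orbit_def periodic_orbit_def)
    then show False using no_fast orbit(2) by fastforce
  qed
  then have XF: "hamiltonian_vf ?F (\<gamma> t) = f' (H (\<gamma> t)) *\<^sub>R hamiltonian_vf H (\<gamma> t)" for t
    using XF_outside k by simp
  have "?DH x (f' (H x) *\<^sub>R hamiltonian_vf H x) = 0" for x
    using linear_scale[OF linear_frechet_derivative[OF Hd[of x]]] XH[of x "hamiltonian_vf H x"]
    by (simp add: symp_form_refl)
  then obtain s where s: "\<And>t. H (\<gamma> t) = s"
    using constant_along[of H] Hd unfolding XF by blast
  \<comment> \<open>Zero slope would make the orbit stationary. Being nonconstant, it lies where the
    cutoff is not flat, hence above \<open>a\<close>.\<close>
  have "f' s \<noteq> 0"
  proof
    assume "f' s = 0"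
    then have "(\<gamma> has_derivative (\<lambda>h. 0)) (at t within UNIV)" for t
      using der[of t] by (simp add: XF s has_vector_derivative_def)
    then have "\<gamma> constant_on UNIV"
      using has_derivative_zero_constant[of UNIV \<gamma>] by (auto simp: constant_on_def)
    then show False using nonconst by blast
  qed
  moreover have "a < s" using f(2)[of s] \<open>f' s \<noteq> 0\<close> by linarith
  moreover have "periodic_orbit H {x. H x = s} (\<lambda>t. \<gamma> (t / f' s)) (\<bar>f' s\<bar> * T)"
    by (rule periodic_orbit_reparametrize[OF per]) (use XF s \<open>f' s \<noteq> 0\<close> in auto)
  ultimately show ?thesis using that s by blast
qed

section \<open>Raising an admissible function on a larger sublevel set\<close>

text \<open>\<open>V\<close> and the complement of the support cover the space, and the extension is
  smooth on both. Compactness makes the support closed in the whole space, not only in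
  \<open>V\<close>.\<close>

lemma smooth_on_extend_by_zero:
  fixes K :: "'a::euclidean_space \<Rightarrow> real"
  assumes "open V" "smooth_on V K" "compact (V \<inter> closure {x\<in>V. K x \<noteq> 0})"
  shows "smooth_on UNIV (\<lambda>x. if x \<in> V then K x else 0)"
  unfolding smooth_on_def
proof
  fix k
  let ?S = "V \<inter> closure {x\<in>V. K x \<noteq> 0}" and ?K = "\<lambda>x. if x \<in> V then K x else 0"
  have op: "open (- ?S)" using compact_imp_closed[OF assms(3)] by (rule open_Compl)
  have "Ck_on k V ?K"
    by (rule Ck_on_cong[OF assms(1), of K]) (use assms(2) in \<open>auto simp: smooth_on_def\<close>)
  moreover have "Ck_on k (- ?S) ?K"
  proof (rule Ck_on_cong[OF op _ Ck_on_const[OF op]])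
    show "0 = ?K x" if "x \<in> - ?S" for x
      using that closure_subset[of "{x\<in>V. K x \<noteq> 0}"] by auto
  qed
  moreover have "V \<union> - ?S = UNIV" by auto
  ultimately show "Ck_on k UNIV ?K"
    using Ck_on_Un[OF assms(1) op] by metis
qed

text \<open>\<open>F\<close> belongs to the class, but its maximum exceeds the capacity of
  \<open>{H < b}\<close>, so it can fail admissibility only by having a fast orbit. A period of at
  most one times a slope of at most \<sigma> gives the bound on \<open>T\<close>.\<close>

lemma orbit_in_shell_of_capacity_growth:
  fixes H K :: "'n::finite phase \<Rightarrow> real"
  assumes H: "smooth_on UNIV H" and proper: "\<And>c. compact {x. H x \<le> c}"
    and "a < b" "0 < \<tau>" "\<tau> < \<sigma>"
    and K: "HZ_admissible {x. H x < a} K"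
    and cap: "HZ_capacity {x. H x < b} < ereal (Sup (K ` {x. H x < a}) + \<tau> * (b - a))"
  obtains s \<gamma> T where "a < s" "s < b" "periodic_orbit H {x. H x = s} \<gamma> T" "T \<le> \<sigma>"
proof -
  let ?A = "{x. H x < a}" and ?B = "{x. H x < b}"
  have H_Ck: "Ck_on k UNIV H" for k using H by (simp add: smooth_on_def)
  have Hd: "H differentiable (at x)" for x
    using Ck_on_SucE[OF H_Ck UNIV_I] unfolding differentiable_def by blast
  have Hc: "continuous_on UNIV H" using H_Ck[of 0] by simp
  have opA: "open ?A" and opB: "open ?B"
    using Hc by (auto intro!: open_Collect_less continuous_intros)
  have Kcl: "smooth_on ?A K" "\<And>x. x \<in> ?A \<Longrightarrow> 0 \<le> K x" "compact (?A \<inter> closure {x\<in>?A. K x \<noteq> 0})"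
    using K by (auto simp: HZ_admissible_def HZ_class_def)
  have "\<exists>U. open U \<and> U \<noteq> {} \<and> U \<subseteq> ?A \<and> (\<forall>x\<in>U. \<forall>y\<in>?A. K y \<le> K x)"
    using K unfolding HZ_admissible_def HZ_class_def by blast
  then obtain U where U: "open U" "U \<noteq> {}" "U \<subseteq> ?A" "\<And>x y. x \<in> U \<Longrightarrow> y \<in> ?A \<Longrightarrow> K y \<le> K x"
    by blast
  have no_fast: "1 < T" if "nontrivial_periodic_orbit K ?A \<gamma> T" for \<gamma> T
    using K that by (auto simp: HZ_admissible_def not_le)
  obtain f f' :: "real \<Rightarrow> real" and b' c where
    f_Ck: "\<And>k. Ck_on k UNIV f" and f': "\<And>t. (f has_real_derivative f' t) (at t)"
    "\<And>t. \<bar>f' t\<bar> \<le> \<sigma>" "\<And>t. t \<le> a \<Longrightarrow> f' t = 0" and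
    f: "\<And>t. t \<le> a \<Longrightarrow> f t = c" "b' < b"
    "\<And>t. t \<ge> b' \<Longrightarrow> f t = 0" "\<And>t. 0 \<le> f t" "\<And>t. f t \<le> c" "c \<ge> \<tau> * (b - a)"
    by (rule smooth_cutoff_with_slope[OF assms(3-5)]) blast
  \<comment> \<open>Otherwise \<open>f a\<close> would be both \<open>c > 0\<close> and
    \<open>0\<close>. Consequently \<open>K0\<close> vanishes beyond \<open>b'\<close> as
    well.\<close>
  have "a < b'"
  proof (rule ccontr)
    assume "\<not> a < b'"
    then have "c = 0" using f(1)[of a] f(3)[of a] by simp
    moreover have "\<tau> * (b - a) > 0" using assms by simp
    ultimately show False using f(6) by simp
  qed
  define K0 where "K0 x = (if x \<in> ?A then K x else 0)" for x
  have K0_smooth: "smooth_on UNIV K0"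
    unfolding K0_def[abs_def] by (rule smooth_on_extend_by_zero[OF opA Kcl(1,3)])
  have K0d: "K0 differentiable (at x)" for x
    using Ck_on_SucE[OF _ UNIV_I] K0_smooth unfolding smooth_on_def differentiable_def by blast
  have K0_nonneg: "0 \<le> K0 x" for x using Kcl(2) by (simp add: K0_def)
  define F where "F x = K0 x + f (H x)" for x
  obtain x0 where x0: "x0 \<in> U" using U(2) by blast
  have F_U: "F x = K x + c" if "x \<in> U" for x
    using that U(3) f(1)[of "H x"] by (auto simp: F_def K0_def)
  \<comment> \<open>The maximum stays on \<open>U\<close>: inside \<open>{H < a}\<close> both values
    are raised by the same \<open>c\<close>, and outside
    \<open>F y = f (H y) \<le> c \<le> F x\<close>.\<close>
  have F_le: "F y \<le> F x" if "x \<in> U" for x y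
  proof (cases "y \<in> ?A")
    case True
    then show ?thesis using U(4)[OF that True] f(1)[of "H y"] F_U[OF that] by (simp add: F_def K0_def)
  next
    case False
    moreover have "0 \<le> K x" using Kcl(2) U(3) that by blast
    ultimately show ?thesis using f(5)[of "H y"] F_U[OF that] by (simp add: F_def K0_def)
  qed
  have UB: "U \<subseteq> ?B" using U(3) assms(3) by auto
  have "F \<in> HZ_class ?B"
    unfolding HZ_class_def
  proof (intro CollectI conjI ballI)
    show "smooth_on ?B F"
      unfolding smooth_on_def
    proof
      fix k
      have "Ck_on k UNIV F"
        unfolding F_def[abs_def]
        by (intro Ck_on_add open_UNIV Ck_on_compose_real[OF _ f_Ck H_Ck])
          (use K0_smooth in \<open>simp add: smooth_on_def\<close>)
      then show "Ck_on k ?B F" by (rule Ck_on_subset) simp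
    qed
    show "0 \<le> F x" for x using K0_nonneg f(4) by (simp add: F_def)
    have "x \<in> {x. H x \<le> b'}" if "F x \<noteq> 0" for x
    proof (rule ccontr)
      assume "x \<notin> {x. H x \<le> b'}"
      then show False
        using that f(3)[of "H x"] \<open>a < b'\<close> by (simp add: F_def K0_def)
    qed
    \<comment> \<open>The support lies in the compact sublevel set at \<open>b' < b\<close>, so it
      does not reach the level \<open>b\<close>.\<close>
    then have sub: "closure {x\<in>?B. F x \<noteq> 0} \<subseteq> {x. H x \<le> b'}"
      using compact_imp_closed[OF proper] by (intro closure_minimal) auto
    then have "?B \<inter> closure {x\<in>?B. F x \<noteq> 0} = {x. H x \<le> b'} \<inter> closure {x\<in>?B. F x \<noteq> 0}"
      using f(2) by auto
    then show "compact (?B \<inter> closure {x\<in>?B. F x \<noteq> 0})"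
      using compact_Int_closed[OF proper] by simp
    show "\<exists>U. open U \<and> U \<noteq> {} \<and> U \<subseteq> ?B \<and> (\<forall>x\<in>U. \<forall>y\<in>?B. F y \<le> F x)"
      using U(1,2) UB F_le by blast
  qed
  moreover have "\<not> HZ_admissible ?B F"
  proof
    assume "HZ_admissible ?B F"
    then have "ereal (Sup (F ` ?B)) \<le> HZ_capacity ?B"
      unfolding HZ_capacity_def by (intro SUP_upper) simp
    moreover have "Sup (F ` ?B) = K x0 + c"
      using F_le[OF x0] F_U[OF x0] x0 UB by (intro cSup_eq_maximum) (auto intro!: rev_image_eqI)
    moreover have "Sup (K ` ?A) = K x0"
      using U(4)[OF x0] x0 U(3) by (intro cSup_eq_maximum) auto
    ultimately have "ereal (K x0 + c) < ereal (K x0 + \<tau> * (b - a))"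
      using cap by (metis order.strict_trans1)
    then show False using f(6) by simp
  qed
  ultimately obtain \<gamma> T where \<gamma>: "nontrivial_periodic_orbit F ?B \<gamma> T" "T \<le> 1"
    by (auto simp: HZ_admissible_def)
  \<comment> \<open>\<open>K0\<close> and \<open>K\<close> agree on an open set, hence have the same
    vector field there, and admissibility of \<open>K\<close> transfers.\<close>
  have K0_no_fast: "1 < T" if "nontrivial_periodic_orbit K0 ?A \<gamma> T" for \<gamma> T
  proof (rule no_fast)
    have "hamiltonian_vf K0 x = hamiltonian_vf K x" if "x \<in> ?A" for x
      unfolding hamiltonian_vf_def
      using frechet_derivative_cong_open[OF opA that, of K0 K] by (simp add: K0_def)
    moreover have "\<gamma> t \<in> ?A" for t
      using that by (simp add: nontrivial_periodic_orbit_def periodic_orbit_def)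
    ultimately have "hamiltonian_vf K0 (\<gamma> t) = hamiltonian_vf K (\<gamma> t)" for t by blast
    then show "nontrivial_periodic_orbit K ?A \<gamma> T"
      using that by (simp add: nontrivial_periodic_orbit_def periodic_orbit_def)
  qed
  have K0_supp: "K0 x = 0" if "a \<le> H x" for x using that by (simp add: K0_def)
  have "\<exists>s. a < s \<and> (\<forall>t. H (\<gamma> t) = s) \<and>
      periodic_orbit H {x. H x = s} (\<lambda>t. \<gamma> (t / f' s)) (\<bar>f' s\<bar> * T)"
    by (rule fast_orbit_of_admissible_plus_cutoff[where H = H and K = K0 and f = f and f' = f'
          and a = a and \<gamma> = \<gamma> and T = T and V = "?B"];
        (fact Hd K0d K0_nonneg K0_supp f'(1,3) K0_no_fast \<gamma>(1)[unfolded F_def[abs_def]] \<gamma>(2)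
          | blast))
  then obtain s where s: "a < s" "\<And>t. H (\<gamma> t) = s"
    "periodic_orbit H {x. H x = s} (\<lambda>t. \<gamma> (t / f' s)) (\<bar>f' s\<bar> * T)"
    by blast
  have "\<gamma> 0 \<in> ?B" "T > 0"
    using \<gamma>(1) by (auto simp: nontrivial_periodic_orbit_def periodic_orbit_def)
  then have "s < b" using s(2)[of 0] by simp
  moreover have "\<bar>f' s\<bar> * T \<le> \<sigma> * 1"
    using f'(2)[of s] \<gamma>(2) \<open>T > 0\<close> assms by (intro mult_mono) auto
  ultimately show ?thesis using that[OF s(1) _ s(3)] by simp
qed

section \<open>From the lower derivative to growth between nearby levels\<close>

text \<open>If \<open>c h\<close> is infinite, every quotient is \<open>\<infinity>\<close> or
  \<open>-\<infinity>\<close>. Either \<open>-\<infinity>\<close> recurs arbitrarily close to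
  \<open>0\<close> and is the lower limit, or the quotients are eventually
  \<open>\<infinity>\<close>.\<close>

lemma lower_derivative_finite_imp_finite:
  assumes "\<bar>lower_derivative c h\<bar> \<noteq> \<infinity>"
  shows "\<bar>c h\<bar> \<noteq> \<infinity>"
proof
  assume inf: "\<bar>c h\<bar> = \<infinity>"
  let ?q = "\<lambda>\<delta>. (c (h + \<delta>) - c h) / ereal \<delta>"
  have q: "?q \<delta> = \<infinity> \<or> ?q \<delta> = -\<infinity>" if "\<delta> \<noteq> 0" for \<delta>
    using inf that by (cases "c h"; cases "c (h + \<delta>)") (auto simp: divide_ereal_def)
  show False
  proof (cases "\<exists>\<^sub>F \<delta> in at 0. ?q \<delta> = -\<infinity>")
    case True
    have "Liminf (at 0) ?q = -\<infinity>"
    proof (rule ccontr)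
      assume "Liminf (at 0) ?q \<noteq> -\<infinity>"
      then have "-\<infinity> < Liminf (at 0) ?q" by simp
      then have "\<forall>\<^sub>F \<delta> in at 0. -\<infinity> < ?q \<delta>"
        using less_LiminfD by blast
      then show False using True by (auto simp: frequently_def)
    qed
    then show False using assms by (simp add: lower_derivative_def)
  next
    case False
    then have "\<forall>\<^sub>F \<delta> in at 0. \<infinity> \<le> ?q \<delta>"
      unfolding not_frequently using eventually_neq_at_within[of 0 0 UNIV]
      by eventually_elim (use q in auto)
    from Liminf_bounded[OF this] show False
      using assms by (simp add: lower_derivative_def)
  qed
qed

text \<open>A lower limit below \<tau> is witnessed by arbitrarily small \<delta> with quotient
  below \<tau>. For negative \<delta>, clearing the denominator reverses the inequality and swaps
  the roles of \<open>h\<close> and \<open>h + \<delta>\<close>, so both signs give the same form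
  with \<open>a < b\<close>.\<close>

lemma capacity_growth_of_lower_derivative:
  assumes "lower_derivative c h < ereal \<tau>" "\<bar>c h\<bar> \<noteq> \<infinity>" "0 < e"
  obtains a b where "a < b" "\<bar>a - h\<bar> < e" "\<bar>b - h\<bar> < e" "c b < c a + ereal (\<tau> * (b - a))"
proof -
  let ?q = "\<lambda>\<delta>. (c (h + \<delta>) - c h) / ereal \<delta>"
  obtain r where r: "c h = ereal r" using assms(2) by auto
  have "\<exists>\<^sub>F \<delta> in at 0. ?q \<delta> < ereal \<tau>"
  proof (rule ccontr)
    assume "\<not> (\<exists>\<^sub>F \<delta> in at 0. ?q \<delta> < ereal \<tau>)"
    then have "\<forall>\<^sub>F \<delta> in at 0. ereal \<tau> \<le> ?q \<delta>" by (simp add: not_frequently not_less)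
    from Liminf_bounded[OF this] show False using assms(1) by (simp add: lower_derivative_def)
  qed
  moreover have "\<forall>\<^sub>F \<delta> in at (0::real). \<delta> \<noteq> 0 \<and> \<bar>\<delta>\<bar> < e"
    using assms(3) by (auto simp: eventually_at intro!: exI[of _ e])
  ultimately have "\<exists>\<^sub>F \<delta> in at 0. ?q \<delta> < ereal \<tau> \<and> \<delta> \<noteq> 0 \<and> \<bar>\<delta>\<bar> < e"
    by (rule frequently_eventually_frequently)
  then obtain \<delta> where \<delta>: "?q \<delta> < ereal \<tau>" "\<delta> \<noteq> 0" "\<bar>\<delta>\<bar> < e"
    using frequently_ex by blast
  show ?thesis
  proof (cases "\<delta> > 0")
    case True
    then have "c (h + \<delta>) < c h + ereal (\<tau> * (h + \<delta> - h))"
      using \<delta>(1) r by (cases "c (h + \<delta>)") (auto simp: field_simps)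
    then show ?thesis using that[of h "h + \<delta>"] True \<delta>(3) by simp
  next
    case False
    then have "c h < c (h + \<delta>) + ereal (\<tau> * (h - (h + \<delta>)))"
      using \<delta>(1,2) r by (cases "c (h + \<delta>)") (auto simp: field_simps)
    then show ?thesis using that[of "h + \<delta>" h] False \<delta>(2,3) by simp
  qed
qed

theorem proposition4p2:
  fixes H :: "'n::finite phase \<Rightarrow> real" and z :: "'n phase" and h :: real
  assumes "smooth_on UNIV H"
    and "proper_map euclidean euclidean H"
    and "bdd_below (range H)"
    and "\<forall>x. H z \<le> H x"
    and "\<forall>x. (\<forall>v. frechet_derivative H (at x) v = 0) \<longleftrightarrow> x = z"
    and "h > H z"
    and "\<bar>lower_derivative (capacity_function H) h\<bar> \<noteq> \<infinity>"
  shows "(\<exists>\<gamma> T. nontrivial_periodic_orbit H {x. H x = h} \<gamma> T \<and>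
            ereal T \<le> lower_derivative (capacity_function H) h) \<and>
         lower_derivative (capacity_function H) h > 0"
proof -
  let ?c = "capacity_function H"
  obtain d where d: "lower_derivative ?c h = ereal d" using assms(7) by auto
  have ch: "\<bar>?c h\<bar> \<noteq> \<infinity>" by (rule lower_derivative_finite_imp_finite[OF assms(7)])
  have H_Ck: "Ck_on k UNIV H" for k using assms(1) by (simp add: smooth_on_def)
  have Hd: "H differentiable (at x)" for x
    using Ck_on_SucE[OF H_Ck UNIV_I] unfolding differentiable_def by blast
  have Hc: "continuous_on UNIV H" using H_Ck[of 0] by simp
  have proper: "compact {x. H x \<le> c}" for c
  proof -
    have "compactin euclidean {x \<in> topspace euclidean. H x \<in> {H z..c}}"
      by (rule compactin_proper_map_preimage[OF assms(2)]) simp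
    then show ?thesis using assms(4) by simp
  qed
  \<comment> \<open>The sign of \<open>d\<close> is not known yet; the maximum keeps the slopes
    positive until the limit orbit settles it.\<close>
  define L where "L = max d 0"
  \<comment> \<open>The first bound forces the levels to converge to \<open>h\<close>; the second
    keeps them above the midpoint of \<open>H z\<close> and \<open>h\<close>.\<close>
  define e where "e n = min (1 / Suc n) ((h - H z) / 2)" for n :: nat
  have e: "0 < e n" "e n \<le> 1 / Suc n" "e n \<le> (h - H z) / 2" for n
    unfolding e_def using assms(6) by (simp_all only: min.cobounded1 min.cobounded2) simp
  have "\<exists>s \<gamma> T. \<bar>s - h\<bar> < e n \<and> periodic_orbit H {x. H x = s} \<gamma> T \<and> T \<le> L + 2 / Suc n" for n
  proof -
    \<comment> \<open>Strictly above both \<open>d\<close> and \<open>0\<close>, and strictly below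
      the slope bound \<open>L + 2 / Suc n\<close>, as the cutoff requires.\<close>
    define \<tau> where "\<tau> = L + 1 / Suc n"
    have "L < \<tau>" by (simp add: \<tau>_def)
    then have \<tau>: "d < \<tau>" "0 < \<tau>" by (simp_all add: L_def)
    have \<tau>2: "\<tau> < L + 2 / Suc n"
      unfolding \<tau>_def by (intro add_strict_left_mono divide_strict_right_mono) auto
    have "lower_derivative ?c h < ereal \<tau>" using d \<tau> by simp
    then obtain a b where ab: "a < b" "\<bar>a - h\<bar> < e n" "\<bar>b - h\<bar> < e n"
      "?c b < ?c a + ereal (\<tau> * (b - a))"
      by (rule capacity_growth_of_lower_derivative[where c = ?c and h = h and \<tau> = \<tau> and e = "e n",
            OF _ ch e(1)])
    \<comment> \<open>Isolating the supremum \<open>?c a\<close> on one side lets a single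
      admissible \<open>K\<close> witness the strict inequality.\<close>
    have "?c b - ereal (\<tau> * (b - a)) < ?c a"
      using ab(4) by (cases "?c a"; cases "?c b") auto
    then obtain K where K: "HZ_admissible {x. H x < a} K"
      "?c b - ereal (\<tau> * (b - a)) < ereal (Sup (K ` {x. H x < a}))"
      unfolding capacity_function_def[of H a] HZ_capacity_def less_SUP_iff by blast
    have "HZ_capacity {x. H x < b} < ereal (Sup (K ` {x. H x < a}) + \<tau> * (b - a))"
      using K(2) unfolding capacity_function_def
      by (cases "HZ_capacity {x. H x < b}") auto
    then obtain s \<gamma> T where "a < s" "s < b" "periodic_orbit H {x. H x = s} \<gamma> T" "T \<le> L + 2 / Suc n"
      using orbit_in_shell_of_capacity_growth[OF assms(1) proper ab(1) \<tau>(2) \<tau>2 K(1)] by blast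
    then show ?thesis using ab(2,3) by (intro exI[of _ s] exI[of _ \<gamma>] exI[of _ T]) auto
  qed
  then obtain s \<gamma> T where orb: "\<And>n. \<bar>s n - h\<bar> < e n" "\<And>n. periodic_orbit H {x. H x = s n} (\<gamma> n) (T n)"
    "\<And>n. T n \<le> L + 2 / Suc n" by metis
  \<comment> \<open>A compact shell containing all the orbits: the upper bound gives compactness by
    properness, the lower one cuts off the critical point \<open>z\<close>.\<close>
  define C where "C = {x. H x \<le> h + 1} \<inter> {x. (H z + h) / 2 \<le> H x}"
  have "compact C"
    unfolding C_def using Hc
    by (intro compact_Int_closed proper closed_Collect_le continuous_intros)
  have inC: "\<gamma> n t \<in> C" for n t
  proof -
    have "H (\<gamma> n t) = s n" using orb(2) by (simp add: periodic_orbit_def)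
    moreover have "1 / real (Suc n) \<le> 1" by simp
    then have "e n \<le> 1" using e(2)[of n] by linarith
    ultimately show ?thesis
      using orb(1)[of n] e(3)[of n] by (auto simp: C_def abs_less_iff field_simps)
  qed
  have nz: "hamiltonian_vf H x \<noteq> 0" if "x \<in> C" for x
  proof
    assume "hamiltonian_vf H x = 0"
    then have "\<forall>v. frechet_derivative H (at x) v = 0"
      using hamiltonian_vf_gradient(2)[OF Hd, of x] by (simp add: symp_form_def)
    then have "x = z" using assms(5) by blast
    then show False using assms(6) that by (auto simp: C_def)
  qed
  have inv: "(\<lambda>n. c / real (Suc n)) \<longlonglongrightarrow> 0" for c
    by (rule LIMSEQ_Suc[OF lim_const_over_n])
  have slim: "s \<longlonglongrightarrow> h"
  proof (rule LIM_zero_cancel, rule Lim_null_comparison[OF _ inv[of 1]])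
    show "\<forall>\<^sub>F n in sequentially. norm (s n - h) \<le> 1 / real (Suc n)"
      using orb(1) e(2) by (intro always_eventually allI) (metis less_imp_le order_trans real_norm_def)
  qed
  have Llim: "(\<lambda>n. L + 2 / real (Suc n)) \<longlonglongrightarrow> L"
    using tendsto_add[OF tendsto_const inv[of 2]] by simp
  obtain \<gamma>' T' where \<gamma>': "nontrivial_periodic_orbit H {x. H x = h} \<gamma>' T'" "T' \<le> L"
    by (rule periodic_orbit_limit[OF Hc continuous_on_hamiltonian_vf[OF H_Ck] \<open>compact C\<close> orb(2)
          inC nz slim Llim orb(3)])
  then have "T' > 0" by (simp add: nontrivial_periodic_orbit_def periodic_orbit_def)
  \<comment> \<open>Since \<open>0 < T' \<le> max d 0\<close>, the maximum must be \<open>d\<close>;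
    this is where positivity of the lower derivative comes from.\<close>
  then have "T' \<le> d" "d > 0" using \<gamma>'(2) by (auto simp: L_def split: if_splits)
  then show ?thesis using \<gamma>'(1) d by auto
qed

end
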